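(* Let $\bar\xi\in\mathbb{R}^n$ be a zero of $r$ and $\bar u:=\tilde u(\bar\xi)$. Assume that the matrix $\nabla^2g(\bar u)$ is positive semidefinite. Then there exist $\rho,\tau_0>0$ such that for all $\xi_0\in\mathbb{R}^n$ with $|\xi_0-\bar\xi|<\rho$ and all $\tau\in(0,\tau_0)$, the sequence $(\xi_k)\subset\mathbb{R}^n$ inductively defined via $\xi_{k+1}:=\xi_k+\tau r(\xi_k)$ converges r-linearly towards $\bar\xi$.
   Context: $|\cdot|$ is the Euclidean norm. $F=\{a_1,\ldots,a_n\}\subset\mathbb{R}^2$ is a finite set of pairwise distinct points; $D\subset\mathbb{R}^2$ is a convex compact polygon with nonempty interior; $u_d$ is a nonnegative Borel measure on $D$, absolutely continuous w.r.t. the Lebesgue measure, with density $\varrho$ continuous on $D$; $\alpha>0$. $g\colon\mathbb{R}^n\to\mathbb{R}$ is twice continuously differentiable with gradient $\nabla g$ and Hessian $\nabla^2g$. For $\xi\in\mathbb{R}^n$: $D_i(\xi):=\{x\in\operatorname{int}(D): a_i^\top x-\xi_i>a_j^\top x-\xi_j\ \forall j\ne i\}$; $\tilde u(\xi):=(u_d(D_1(\xi)),\ldots,u_d(D_n(\xi)))^\top\in\mathbb{R}^n$; $A:=\frac12(|a_1|^2,\ldots,|a_n|^2)^\top$; $r(\xi):=A+\frac1\alpha\nabla g(\tilde u(\xi))-\xi$. R-linear convergence of $\xi_k$ to $\bar\xi$ means that there are $C\geq0$ and $q\in(0,1)$ with $|\xi_k-\bar\xi|\le Cq^k$ for all $k$.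 *)

theory Defs
  imports "HOL-Analysis.Analysis"
begin

text \<open>A family of pairwise distinct points indexed by \<^typ>\<open>'n::finite\<close> is an injective
  function \<^term>\<open>a :: 'n::finite \<Rightarrow> real ^ 2\<close>; vectors in n-space are of type \<^typ>\<open>real ^ 'n::finite\<close>.\<close>

definition cell :: "('n::finite \<Rightarrow> real ^ 2) \<Rightarrow> (real ^ 2) set \<Rightarrow> real ^ 'n \<Rightarrow> 'n \<Rightarrow> (real ^ 2) set"
  where "cell a D \<xi> i =
    {x \<in> interior D. \<forall>j. j \<noteq> i \<longrightarrow> a i \<bullet> x - \<xi> $ i > a j \<bullet> x - \<xi> $ j}"

definition cell_volumes ::
    "(real ^ 2) measure \<Rightarrow> ('n::finite \<Rightarrow> real ^ 2) \<Rightarrow> (real ^ 2) set \<Rightarrow> real ^ 'n \<Rightarrow> real ^ 'n"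
  where "cell_volumes ud a D \<xi> = (\<chi> i. measure ud (cell a D \<xi> i))"

definition half_sq_norms :: "('n::finite \<Rightarrow> real ^ 2) \<Rightarrow> real ^ 'n"
  where "half_sq_norms a = (1 / 2) *\<^sub>R (\<chi> i. (norm (a i))\<^sup>2)"

text \<open>The argument \<open>grad_g\<close> is the gradient field of the function g.\<close>

definition residual_map ::
    "(real ^ 2) measure \<Rightarrow> ('n::finite \<Rightarrow> real ^ 2) \<Rightarrow> (real ^ 2) set \<Rightarrow> real \<Rightarrow>
     (real ^ 'n \<Rightarrow> real ^ 'n) \<Rightarrow> real ^ 'n \<Rightarrow> real ^ 'n"
  where "residual_map ud a D \<alpha> grad_g \<xi> =
    half_sq_norms a + (1 / \<alpha>) *\<^sub>R grad_g (cell_volumes ud a D \<xi>) - \<xi>"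

text \<open>The gradient and the Hessian are uniquely determined by the first two conjuncts.\<close>

definition twice_cont_differentiable ::
    "(real ^ 'n::finite \<Rightarrow> real) \<Rightarrow> (real ^ 'n \<Rightarrow> real ^ 'n) \<Rightarrow> (real ^ 'n \<Rightarrow> real ^ 'n ^ 'n) \<Rightarrow> bool"
  where "twice_cont_differentiable g grad_g H \<longleftrightarrow>
    (\<forall>x. GDERIV g x :> grad_g x) \<and>
    (\<forall>x. (grad_g has_derivative (\<lambda>h. H x *v h)) (at x)) \<and>
    continuous_on UNIV H"

text \<open>Symmetry is not part of this definition; it is applied below only to the Hessian of a
  twice continuously differentiable function, which is symmetric anyway.\<close>

definition pos_semidefinite :: "real ^ 'n ^ 'n::finite \<Rightarrow> bool"
  where "pos_semidefinite M \<longleftrightarrow> (\<forall>v. 0 \<le> v \<bullet> (M *v v))"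

primrec fixed_step_iteration ::
    "('a::real_vector \<Rightarrow> 'a) \<Rightarrow> real \<Rightarrow> 'a \<Rightarrow> nat \<Rightarrow> 'a"
  where
    "fixed_step_iteration r \<tau> \<xi>\<^sub>0 0 = \<xi>\<^sub>0"
  | "fixed_step_iteration r \<tau> \<xi>\<^sub>0 (Suc k) =
       fixed_step_iteration r \<tau> \<xi>\<^sub>0 k + \<tau> *\<^sub>R r (fixed_step_iteration r \<tau> \<xi>\<^sub>0 k)"

definition r_linearly_convergent :: "(nat \<Rightarrow> 'a::real_normed_vector) \<Rightarrow> 'a \<Rightarrow> bool"
  where "r_linearly_convergent \<xi> l \<longleftrightarrow>
    (\<exists>C\<ge>0. \<exists>q. 0 < q \<and> q < 1 \<and> (\<forall>k. norm (\<xi> k - l) \<le> C * q ^ k))"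

end

theory Submission
  imports Defs
begin

text \<open>
  The cell volumes \<open>\<xi> \<mapsto> cell_volumes ud a D \<xi>\<close> form the negative gradient of the convex function
  \<open>\<xi> \<mapsto> \<integral> max\<^sub>i (a i \<bullet> x - \<xi> $ i) dud(x)\<close>, and this gradient is Lipschitz. It is therefore cocoercive: for
  \<open>e = \<xi> - \<eta>\<close> and the difference \<open>d\<close> of the two volume vectors, \<open>(norm d)\<^sup>2 \<le> M * - (d \<bullet> e)\<close>. This
  inequality is the only property of the cells that the convergence proof uses. It is proved
  directly in \<open>cell_volumes_cocoercive\<close>, by counting the mass that passes between each pair of cells:
  a pair exchanges mass only in one direction, and only within a slab whose width is the change
  of the relative potential. No differentiability of the volumes is involved; it can fail, for
  instance when a cell boundary runs along an edge of \<open>D\<close>.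

  Near the zero, the residual is \<open>- e + A d / \<alpha>\<close> up to a small error, where \<open>A\<close> is the Hessian of \<open>g\<close>.
  The product of \<open>A\<close> and the averaged derivative of the volumes is a product of a positive and a
  negative semidefinite symmetric matrix; it has nonpositive eigenvalues, but it need not be dissipative
  in the Euclidean norm. It nearly is in the norm \<open>e \<bullet> P e\<close> with \<open>P\<close> the inverse of \<open>A + \<epsilon> I\<close>:
  there \<open>P e \<bullet> A d = e \<bullet> d - \<epsilon> * (P e \<bullet> d)\<close>, cocoercivity makes the first term negative, and for small
  \<open>\<epsilon>\<close> it absorbs most of the second. The remaining part is dominated by the damping \<open>- e\<close>. This is
  \<open>fixed_step_local_r_linear\<close>; it needs \<open>A\<close> to be symmetric, which is \<open>hessian_symmetric\<close>. The
  passage from the decay of this quadratic form along the vector field to the decay along the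
  fixed-step iteration is \<open>euler_iteration_r_linear\<close>.
\<close>

section \<open>Symmetry of the Hessian\<close>

text \<open>By the mean value theorem in the direction \<open>u\<close>, the second difference \<open>\<Delta> t u v\<close> of \<open>g\<close> over
the parallelogram spanned by \<open>t u\<close> and \<open>t v\<close> is \<open>t\<^sup>2 (u \<bullet> A v)\<close> up to \<open>o(t\<^sup>2)\<close>. The second
difference is symmetric in \<open>u\<close> and \<open>v\<close>, hence so is the coefficient. Differentiability of the
gradient at the single point \<open>x\<close> suffices, because the expansion of \<open>G\<close> is taken around \<open>x\<close> at
both points that the mean value theorem produces.\<close>

lemma hessian_symmetric:
  fixes g :: "'a::real_inner \<Rightarrow> real"
  assumes grad: "\<And>y. GDERIV g y :> G y"
    and der: "(G has_derivative A) (at x)"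
  shows "u \<bullet> A v = v \<bullet> A u"
proof -
  define \<Delta> where "\<Delta> t u v = g (x + t *\<^sub>R u + t *\<^sub>R v) - g (x + t *\<^sub>R u) - g (x + t *\<^sub>R v) + g x" for t u v
  have lin: "bounded_linear A" using der by (rule has_derivative_bounded_linear)
  interpret A: bounded_linear A by fact
  have key: "\<exists>d>0. \<forall>t. 0 < t \<and> t < d \<longrightarrow>
      \<bar>\<Delta> t u v - t\<^sup>2 * (u \<bullet> A v)\<bar> \<le> t\<^sup>2 * (\<kappa> * (norm u * (2 * norm u + norm v)))"
    if "\<kappa> > 0" for \<kappa> u v
  proof -
    obtain d where d: "d > 0"
      and dle: "\<And>y. norm (y - x) < d \<Longrightarrow> norm (G y - G x - A (y - x)) \<le> \<kappa> * norm (y - x)"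
      using der \<open>\<kappa> > 0\<close> unfolding has_derivative_at_alt by blast
    define K where "K = norm u + norm v + 1"
    have K: "K > 0" unfolding K_def by (smt (verit) norm_ge_zero)
    have "\<bar>\<Delta> t u v - t\<^sup>2 * (u \<bullet> A v)\<bar> \<le> t\<^sup>2 * (\<kappa> * (norm u * (2 * norm u + norm v)))"
      if t: "0 < t" "t < d / K" for t
    proof -
      define \<phi> where "\<phi> s = g (x + s *\<^sub>R u + t *\<^sub>R v) - g (x + s *\<^sub>R u)" for s
      have D: "(\<phi> has_field_derivative u \<bullet> (G (x + s *\<^sub>R u + t *\<^sub>R v) - G (x + s *\<^sub>R u))) (at s)" for s
      proof -
        have gd: "(g has_derivative (\<lambda>h. h \<bullet> G y)) (at y)" for y
          using grad[of y] by (simp add: gderiv_def)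
        have 1: "((\<lambda>s. g (x + s *\<^sub>R u + t *\<^sub>R v)) has_derivative
              (\<lambda>h. (h *\<^sub>R u) \<bullet> G (x + s *\<^sub>R u + t *\<^sub>R v))) (at s)"
          by (rule has_derivative_compose[OF _ gd]) (auto intro!: derivative_eq_intros)
        have 2: "((\<lambda>s. g (x + s *\<^sub>R u)) has_derivative (\<lambda>h. (h *\<^sub>R u) \<bullet> G (x + s *\<^sub>R u))) (at s)"
          by (rule has_derivative_compose[OF _ gd]) (auto intro!: derivative_eq_intros)
        have "(\<phi> has_derivative
            (\<lambda>h. (h *\<^sub>R u) \<bullet> G (x + s *\<^sub>R u + t *\<^sub>R v) - (h *\<^sub>R u) \<bullet> G (x + s *\<^sub>R u))) (at s)"
          unfolding \<phi>_def by (rule has_derivative_diff[OF 1 2])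
        then show ?thesis
          unfolding has_field_derivative_def
          by (rule has_derivative_eq_rhs) (auto simp: fun_eq_iff inner_diff_right algebra_simps)
      qed
      obtain s where s: "0 < s" "s < t"
        and eq: "\<phi> t - \<phi> 0 = (t - 0) * (u \<bullet> (G (x + s *\<^sub>R u + t *\<^sub>R v) - G (x + s *\<^sub>R u)))"
        using MVT2[OF t(1) D] by blast
      define R where "R w = G (x + w) - G x - A w" for w
      have tK: "t * norm u + t * norm v < d"
      proof -
        have "t * norm u + t * norm v \<le> t * K" using t(1) by (simp add: K_def algebra_simps)
        also have "\<dots> < d" using t K by (simp add: field_simps)
        finally show ?thesis .
      qed
      have su: "norm (s *\<^sub>R u) \<le> t * norm u" using s by (simp add: mult_right_mono)
      have suv: "norm (s *\<^sub>R u + t *\<^sub>R v) \<le> t * norm u + t * norm v"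
        using norm_triangle_ineq[of "s *\<^sub>R u" "t *\<^sub>R v"] su t(1) by simp
      have R1: "norm (R (s *\<^sub>R u)) \<le> \<kappa> * (t * norm u)"
      proof -
        have "norm (s *\<^sub>R u) < d"
          using su tK t(1) by (smt (verit) mult_nonneg_nonneg norm_ge_zero)
        then have "norm (R (s *\<^sub>R u)) \<le> \<kappa> * norm (s *\<^sub>R u)"
          using dle[of "x + s *\<^sub>R u"] by (simp add: R_def)
        also have "\<dots> \<le> \<kappa> * (t * norm u)" using su \<open>\<kappa> > 0\<close> by (intro mult_left_mono) auto
        finally show ?thesis .
      qed
      have R2: "norm (R (s *\<^sub>R u + t *\<^sub>R v)) \<le> \<kappa> * (t * norm u + t * norm v)"
      proof -
        have "norm (R (s *\<^sub>R u + t *\<^sub>R v)) \<le> \<kappa> * norm (s *\<^sub>R u + t *\<^sub>R v)"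
          using dle[of "x + (s *\<^sub>R u + t *\<^sub>R v)"] suv tK by (simp add: R_def)
        also have "\<dots> \<le> \<kappa> * (t * norm u + t * norm v)"
          using suv \<open>\<kappa> > 0\<close> by (intro mult_left_mono) auto
        finally show ?thesis .
      qed
      have "G (x + s *\<^sub>R u + t *\<^sub>R v) - G (x + s *\<^sub>R u)
          = t *\<^sub>R A v + (R (s *\<^sub>R u + t *\<^sub>R v) - R (s *\<^sub>R u))"
        by (simp add: R_def A.add A.scaleR add.assoc)
      moreover have "\<Delta> t u v = \<phi> t - \<phi> 0" by (simp add: \<Delta>_def \<phi>_def)
      ultimately have "\<Delta> t u v = t * (u \<bullet> (t *\<^sub>R A v + (R (s *\<^sub>R u + t *\<^sub>R v) - R (s *\<^sub>R u))))"
        using eq by simp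
      then have "\<Delta> t u v - t\<^sup>2 * (u \<bullet> A v)
          = t * (u \<bullet> (R (s *\<^sub>R u + t *\<^sub>R v) - R (s *\<^sub>R u)))"
        by (simp add: inner_add_right power2_eq_square algebra_simps)
      also have "\<bar>\<dots>\<bar> \<le> t * (norm u * norm (R (s *\<^sub>R u + t *\<^sub>R v) - R (s *\<^sub>R u)))"
        using t(1) by (simp add: abs_mult Cauchy_Schwarz_ineq2)
      also have "\<dots> \<le> t * (norm u * (\<kappa> * (t * norm u + t * norm v) + \<kappa> * (t * norm u)))"
        using R1 R2 norm_triangle_ineq4[of "R (s *\<^sub>R u + t *\<^sub>R v)" "R (s *\<^sub>R u)"] t(1)
        by (intro mult_left_mono) auto
      also have "\<dots> = t\<^sup>2 * (\<kappa> * (norm u * (2 * norm u + norm v)))"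
        by (simp add: power2_eq_square algebra_simps)
      finally show ?thesis .
    qed
    then show ?thesis using d K by (intro exI[of _ "d / K"]) simp
  qed
  define L where "L = norm u * (2 * norm u + norm v) + norm v * (2 * norm v + norm u)"
  have "\<bar>u \<bullet> A v - v \<bullet> A u\<bar> \<le> 0 + \<kappa> * L" if "\<kappa> > 0" for \<kappa>
  proof -
    obtain d1 where d1: "d1 > 0" "\<And>t. 0 < t \<Longrightarrow> t < d1 \<Longrightarrow>
        \<bar>\<Delta> t u v - t\<^sup>2 * (u \<bullet> A v)\<bar> \<le> t\<^sup>2 * (\<kappa> * (norm u * (2 * norm u + norm v)))"
      using key[OF \<open>\<kappa> > 0\<close>] by blast
    obtain d2 where d2: "d2 > 0" "\<And>t. 0 < t \<Longrightarrow> t < d2 \<Longrightarrow>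
        \<bar>\<Delta> t v u - t\<^sup>2 * (v \<bullet> A u)\<bar> \<le> t\<^sup>2 * (\<kappa> * (norm v * (2 * norm v + norm u)))"
      using key[OF \<open>\<kappa> > 0\<close>] by blast
    define t where "t = min d1 d2 / 2"
    have t: "0 < t" "t < d1" "t < d2" using d1(1) d2(1) by (auto simp: t_def)
    have "\<Delta> t u v = \<Delta> t v u" by (simp add: \<Delta>_def algebra_simps)
    then have "\<bar>t\<^sup>2 * (u \<bullet> A v) - t\<^sup>2 * (v \<bullet> A u)\<bar> \<le> t\<^sup>2 * (\<kappa> * L)"
      using d1(2)[OF t(1,2)] d2(2)[OF t(1,3)] unfolding L_def distrib_left by linarith
    then have "t\<^sup>2 * \<bar>u \<bullet> A v - v \<bullet> A u\<bar> \<le> t\<^sup>2 * (\<kappa> * L)"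
      by (simp add: abs_mult flip: right_diff_distrib)
    then show ?thesis using t(1) by simp
  qed
  note bound = this
  have L: "L \<ge> 0" by (simp add: L_def)
  have "\<bar>u \<bullet> A v - v \<bullet> A u\<bar> \<le> 0"
  proof (rule field_le_epsilon)
    fix \<epsilon> :: real assume "\<epsilon> > 0"
    then have "\<bar>u \<bullet> A v - v \<bullet> A u\<bar> \<le> 0 + \<epsilon> / (L + 1) * L" using L by (intro bound) simp
    also have "\<dots> \<le> 0 + \<epsilon>" using L \<open>\<epsilon> > 0\<close> by (simp add: field_simps)
    finally show "\<bar>u \<bullet> A v - v \<bullet> A u\<bar> \<le> 0 + \<epsilon>" .
  qed
  then show ?thesis by simp
qed

section \<open>Cocoercivity of the cell volumes\<close>

text \<open>Here \<open>m i j\<close> is the mass that passes from \<open>i\<close> to \<open>j\<close>, and \<open>d\<close> is the resulting net loss. The mass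
moves up the potential \<open>e\<close>, so that \<open>- (d \<bullet> e)\<close> is a sum of nonnegative terms
\<open>m i j * (e $ j - e $ i)\<close>. Since \<open>m i j\<close> is at most \<open>C\<close> times the rise of the potential, each of
these terms dominates \<open>(m i j)\<^sup>2 / C\<close>, and the squares of the exchanged masses control \<open>d\<close> by
the Cauchy-Schwarz inequality.\<close>

lemma cocoercive_of_exchange:
  fixes m :: "'n::finite \<Rightarrow> 'n \<Rightarrow> real" and C :: real and d e :: "real ^ 'n"
  assumes nonneg: "\<And>i j. 0 \<le> m i j"
    and bound: "\<And>i j. i \<noteq> j \<Longrightarrow> m i j \<le> C * max 0 (e $ j - e $ i)"
    and d: "\<And>i. d $ i = (\<Sum>j\<in>UNIV. m i j - m j i)"
  shows "(norm d)\<^sup>2 \<le> 2 * CARD('n) * C * - (d \<bullet> e)"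
proof -
  define N where "N = real CARD('n)"
  define S where "S = (\<Sum>i\<in>UNIV. \<Sum>j\<in>UNIV. m i j * (e $ j - e $ i))"
  have swap: "(\<Sum>i\<in>UNIV. \<Sum>j\<in>UNIV. m j i * (e $ i - e $ j)) = S"
    unfolding S_def by (rule sum.swap)
  have "(\<Sum>i\<in>UNIV. \<Sum>j\<in>UNIV. m j i * e $ i) = (\<Sum>i\<in>UNIV. \<Sum>j\<in>UNIV. m i j * e $ j)"
    by (rule sum.swap)
  then have S: "- (d \<bullet> e) = S"
    by (simp add: S_def inner_vec_def d sum_distrib_right left_diff_distrib right_diff_distrib
        sum_subtractf)
  \<comment> \<open>The case of a falling potential is harmless: then no mass is exchanged at all.\<close>
  have sq: "(m i j)\<^sup>2 \<le> C * (m i j * (e $ j - e $ i))" if "i \<noteq> j" for i j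
  proof (cases "e $ j - e $ i \<ge> 0")
    case True
    then have "m i j * m i j \<le> m i j * (C * (e $ j - e $ i))"
      using bound[OF that] nonneg by (intro mult_left_mono) auto
    then show ?thesis by (simp add: power2_eq_square mult_ac)
  next
    case False
    then have "m i j = 0" using bound[OF that] nonneg[of i j] by simp
    then show ?thesis by simp
  qed
  have pair: "(m i j - m j i)\<^sup>2 \<le> C * (m i j * (e $ j - e $ i)) + C * (m j i * (e $ i - e $ j))" for i j
  proof (cases "i = j")
    case False
    have "(m i j - m j i)\<^sup>2 \<le> (m i j)\<^sup>2 + (m j i)\<^sup>2"
      using nonneg[of i j] nonneg[of j i] by (simp add: power2_diff)
    then show ?thesis using sq[OF False] sq[OF False[symmetric]] by linarith
  qed simp
  have "(norm d)\<^sup>2 = (\<Sum>i\<in>UNIV. (d $ i)\<^sup>2)"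
    by (simp add: norm_vec_def L2_set_def sum_nonneg)
  also have "\<dots> \<le> (\<Sum>i\<in>UNIV. (\<Sum>j\<in>UNIV. (m i j - m j i)\<^sup>2) * N)"
    unfolding d N_def by (intro sum_mono sum_squared_le_sum_of_squares)
  also have "\<dots> \<le> (\<Sum>i\<in>UNIV. (\<Sum>j\<in>UNIV. C * (m i j * (e $ j - e $ i)) + C * (m j i * (e $ i - e $ j))) * N)"
    by (intro sum_mono mult_right_mono pair) (simp add: N_def)
  also have "\<dots> = (C * S + C * S) * N"
    by (simp add: sum.distrib swap S_def[symmetric] flip: sum_distrib_left sum_distrib_right)
  finally show ?thesis by (simp add: S N_def algebra_simps)
qed

text \<open>A rotation that takes \<open>b\<close> to a multiple of the first coordinate vector puts the part of the slab
that lies in the disc into a rectangle with sides \<open>(t - s) / norm b\<close> and \<open>2 * R\<close>.\<close>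

lemma slab_emeasure_le:
  fixes b :: "real ^ 2"
  assumes b: "b \<noteq> 0" and st: "s \<le> t" and R: "0 \<le> R"
  shows "emeasure lborel {x. norm x \<le> R \<and> s \<le> b \<bullet> x \<and> b \<bullet> x \<le> t} \<le> ennreal (2 * R * (t - s) / norm b)"
    (is "emeasure lborel ?S \<le> _")
proof -
  have "closed ?S"
    by (intro closed_Collect_conj closed_Collect_le continuous_intros)
  moreover have "bounded ?S" by (auto simp: bounded_iff)
  ultimately have "compact ?S" by (simp add: compact_eq_bounded_closed)
  then have S: "?S \<in> lmeasurable" "?S \<in> sets borel" by (auto intro: lmeasurable_compact borel_compact)
  have "(norm (axis 1 (norm b) :: real ^ 2))\<^sup>2 = (norm b)\<^sup>2"
    by (simp only: power2_norm_eq_inner[of "axis 1 (norm b)"] inner_axis_axis) (simp add: power2_eq_square)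
  then have "norm b = norm (axis 1 (norm b) :: real ^ 2)" by simp
  then obtain f where f: "orthogonal_transformation f" and fb: "f b = (axis 1 (norm b) :: real ^ 2)"
    by (rule orthogonal_transformation_exists)
  let ?l = "vector [s / norm b, - R] :: real ^ 2" and ?u = "vector [t / norm b, R] :: real ^ 2"
  have "f ` ?S \<subseteq> cbox ?l ?u"
  proof (rule image_subsetI)
    fix x assume x: "x \<in> ?S"
    have "norm b * f x $ 1 = f b \<bullet> f x" by (simp add: fb inner_axis')
    also have "\<dots> = b \<bullet> x" using f by (simp add: orthogonal_transformation_def)
    finally have "s \<le> norm b * f x $ 1" "norm b * f x $ 1 \<le> t" using x by auto
    then have 1: "s / norm b \<le> f x $ 1" "f x $ 1 \<le> t / norm b"
      using b by (auto simp: field_simps)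
    have "\<bar>f x $ 2\<bar> \<le> norm (f x)" by (rule component_le_norm_cart)
    also have "\<dots> \<le> R" using x f by (simp add: orthogonal_transformation_norm)
    finally have "- R \<le> f x $ 2" "f x $ 2 \<le> R" by auto
    with 1 show "f x \<in> cbox ?l ?u" by (simp add: mem_box_cart forall_2)
  qed
  then have "measure lebesgue (f ` ?S) \<le> measure lebesgue (cbox ?l ?u)"
    using measurable_orthogonal_image[OF f S(1)] by (intro measure_mono_fmeasurable) auto
  also have "\<dots> \<le> (t - s) / norm b * (2 * R)"
    using st R by (auto simp: content_cbox_if_cart UNIV_2 diff_divide_distrib[symmetric])
  finally have "measure lebesgue ?S \<le> 2 * R * (t - s) / norm b"
    by (simp add: measure_orthogonal_image[OF f S(1)] mult_ac)
  then have "emeasure lebesgue ?S \<le> ennreal (2 * R * (t - s) / norm b)"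
    using S(1) by (simp add: emeasure_eq_measure2 ennreal_leI)
  then show ?thesis using S(2) by simp
qed

lemma open_cell: "open (cell a D \<xi> i)"
proof -
  have "cell a D \<xi> i = interior D \<inter> (\<Inter>j\<in>- {i}. {x. a j \<bullet> x - \<xi> $ j < a i \<bullet> x - \<xi> $ i})"
    by (auto simp: cell_def)
  then show ?thesis
    by (auto intro!: open_Int open_INT open_Collect_less continuous_intros)
qed

lemma cell_subset: "cell a D \<xi> i \<subseteq> interior D"
  by (auto simp: cell_def)

lemma cell_disjoint: "i \<noteq> j \<Longrightarrow> cell a D \<xi> i \<inter> cell a D \<xi> j = {}"
  by (fastforce simp: cell_def)

text \<open>A point belongs to the cell of the index that maximises \<open>a j \<bullet> x - \<xi> $ j\<close>, unless the maximum is
attained twice; then the point lies on the hyperplane where the two affine functions agree.\<close>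

lemma interior_subset_cells_or_ties:
  fixes a :: "'n::finite \<Rightarrow> real ^ 2"
  shows "interior D \<subseteq> (\<Union>j. cell a D \<xi> j) \<union> (\<Union>(j, k)\<in>{(j, k). j \<noteq> k}. {x. (a j - a k) \<bullet> x = \<xi> $ j - \<xi> $ k})"
proof
  fix x assume x: "x \<in> interior D"
  define f where "f j = a j \<bullet> x - \<xi> $ j" for j
  have "Max (range f) \<in> range f" by (intro Max_in) auto
  then obtain j where j: "Max (range f) = f j" by (rule rangeE)
  have le: "f k \<le> f j" for k unfolding j[symmetric] by (intro Max_ge) auto
  show "x \<in> (\<Union>j. cell a D \<xi> j) \<union> (\<Union>(j, k)\<in>{(j, k). j \<noteq> k}. {x. (a j - a k) \<bullet> x = \<xi> $ j - \<xi> $ k})"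
  proof (cases "\<exists>k. k \<noteq> j \<and> f k = f j")
    case True
    then obtain k where "k \<noteq> j" "f k = f j" by blast
    then have "j \<noteq> k" "(a j - a k) \<bullet> x = \<xi> $ j - \<xi> $ k" by (auto simp: f_def inner_diff_left)
    then show ?thesis by blast
  next
    case False
    then have "x \<in> cell a D \<xi> j" using x le by (force simp: cell_def f_def order_less_le)
    then show ?thesis by blast
  qed
qed

text \<open>The exchanged masses are \<open>m i j = measure ud (cell a D \<xi> i \<inter> cell a D \<eta> j)\<close>. A point of this
intersection satisfies \<open>\<xi> $ i - \<xi> $ j < (a i - a j) \<bullet> x < \<eta> $ i - \<eta> $ j\<close>, and the width of this
interval is the difference of the components \<open>j\<close> and \<open>i\<close> of \<open>\<xi> - \<eta>\<close>. Hence there is no exchange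
unless the difference is positive, and the exchanged mass is at most proportional to it. This
estimate covers the configurations in which cells are empty, degenerate or share an edge with \<open>D\<close>,
where the cell volumes need not be differentiable.\<close>

lemma cell_volumes_cocoercive:
  fixes a :: "'n::finite \<Rightarrow> real ^ 2" and ud :: "(real ^ 2) measure"
  assumes "inj a" and "bounded D" and "D \<in> sets borel" and "0 \<le> B"
    and sets: "sets ud = sets (restrict_space borel D)"
    and dom: "\<And>S. S \<in> sets borel \<Longrightarrow> S \<subseteq> D \<Longrightarrow> emeasure ud S \<le> ennreal B * emeasure lborel S"
  shows "\<exists>M>0. \<forall>\<xi> \<eta>. (norm (cell_volumes ud a D \<xi> - cell_volumes ud a D \<eta>))\<^sup>2
      \<le> M * - ((cell_volumes ud a D \<xi> - cell_volumes ud a D \<eta>) \<bullet> (\<xi> - \<eta>))"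
proof -
  obtain R where R: "0 < R" "\<And>x. x \<in> D \<Longrightarrow> norm x \<le> R"
    using \<open>bounded D\<close> bounded_pos by blast
  have in_sets: "S \<in> sets ud" if "S \<in> sets borel" "S \<subseteq> D" for S
    using that \<open>D \<in> sets borel\<close> by (simp add: sets sets_restrict_space_iff)
  have space: "space ud = D" using sets_eq_imp_space_eq[OF sets] by (simp add: space_restrict_space)
  interpret finite_measure ud
  proof
    have "emeasure lborel D < \<infinity>" using \<open>bounded D\<close> by (rule emeasure_bounded_finite)
    then have "ennreal B * emeasure lborel D < \<infinity>" by (simp add: ennreal_mult_less_top)
    then show "emeasure ud (space ud) \<noteq> \<infinity>"
      using dom[OF \<open>D \<in> sets borel\<close>] by (auto simp: space top_unique)
  qed
  have cellD: "cell a D \<xi> i \<subseteq> D" for \<xi> i using cell_subset interior_subset by blast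
  have Int_sets: "cell a D \<xi> i \<inter> cell a D \<eta> j \<in> sets ud" for \<xi> \<eta> i j
    using cellD open_cell by (intro in_sets) (auto intro!: borel_open open_Int)
  \<comment> \<open>Up to a null set of ties, the cells of \<open>\<eta>\<close> cover the interior of D.\<close>
  have split: "measure ud (cell a D \<xi> i) = (\<Sum>j\<in>UNIV. measure ud (cell a D \<xi> i \<inter> cell a D \<eta> j))" for \<xi> \<eta> i
  proof -
    let ?U = "\<Union>j. cell a D \<xi> i \<inter> cell a D \<eta> j"
    let ?N = "cell a D \<xi> i - ?U"
    have disj: "disjoint_family (\<lambda>j. cell a D \<xi> i \<inter> cell a D \<eta> j)"
      unfolding disjoint_family_on_def using cell_disjoint[of _ _ a D \<eta>] by blast
    have "?N \<subseteq> (\<Union>(j, k)\<in>{(j, k). j \<noteq> k}. {x. (a j - a k) \<bullet> x = \<eta> $ j - \<eta> $ k})"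
      using cell_subset[of a D \<xi> i] interior_subset_cells_or_ties[of D a \<eta>] by blast
    moreover have "negligible (\<Union>(j, k)\<in>{(j, k). j \<noteq> k}. {x. (a j - a k) \<bullet> x = \<eta> $ j - \<eta> $ k})"
      using \<open>inj a\<close> by (intro negligible_Union_nat negligible_Union) (auto intro!: negligible_hyperplane dest: injD)
    ultimately have neg: "negligible ?N" by (rule negligible_subset[rotated])
    have N: "?N \<in> sets borel"
      by (intro sets.Diff borel_open open_UN open_Int open_cell ballI)
    have "emeasure lborel ?N = 0"
      using neg N by (simp add: negligible_iff_null_sets null_sets_def)
    then have "emeasure ud ?N = 0" using dom[OF N] cellD by force
    then have "measure ud ?N = 0" by (simp add: measure_def)
    moreover have "measure ud ?N = measure ud (cell a D \<xi> i) - measure ud ?U"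
      using cellD open_cell
      by (intro finite_measure_Diff in_sets) (auto intro!: borel_open open_UN open_Int)
    moreover have "measure ud ?U = (\<Sum>j\<in>UNIV. measure ud (cell a D \<xi> i \<inter> cell a D \<eta> j))"
      using Int_sets disj by (intro finite_measure_finite_Union) auto
    ultimately show ?thesis by simp
  qed
  \<comment> \<open>Any common upper bound of the finitely many slab constants will do; the summand 1 makes it
    positive, and the diagonal terms vanish because of division by zero.\<close>
  define C where "C = 1 + (\<Sum>i\<in>UNIV. \<Sum>j\<in>UNIV. 2 * B * R / norm (a i - a j))"
  have summand: "0 \<le> 2 * B * R / norm (a i - a j)" for i j using R \<open>0 \<le> B\<close> by simp
  have C: "2 * B * R / norm (a i - a j) \<le> C" for i j
  proof -
    have "2 * B * R / norm (a i - a j) \<le> (\<Sum>j\<in>UNIV. 2 * B * R / norm (a i - a j))"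
      by (rule member_le_sum) (use summand in auto)
    also have "\<dots> \<le> (\<Sum>i\<in>UNIV. \<Sum>j\<in>UNIV. 2 * B * R / norm (a i - a j))"
      by (rule member_le_sum[where f = "\<lambda>i. \<Sum>j\<in>UNIV. 2 * B * R / norm (a i - a j)"])
        (use summand in \<open>auto intro!: sum_nonneg\<close>)
    finally show ?thesis by (simp add: C_def)
  qed
  have Cpos: "0 < C" unfolding C_def using summand by (intro add_pos_nonneg sum_nonneg) auto
  have exchange: "measure ud (cell a D \<xi> i \<inter> cell a D \<eta> j) \<le> C * max 0 ((\<xi> - \<eta>) $ j - (\<xi> - \<eta>) $ i)"
    if ij: "i \<noteq> j" for \<xi> \<eta> i j
  proof (cases "cell a D \<xi> i \<inter> cell a D \<eta> j = {}")
    case True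
    then show ?thesis using Cpos by simp
  next
    case False
    let ?S = "cell a D \<xi> i \<inter> cell a D \<eta> j"
    define b where "b = a i - a j"
    define w where "w = (\<eta> $ i - \<eta> $ j) - (\<xi> $ i - \<xi> $ j)"
    have b: "b \<noteq> 0" using \<open>inj a\<close> ij by (auto simp: b_def dest: injD)
    have slab: "\<xi> $ i - \<xi> $ j \<le> b \<bullet> x \<and> b \<bullet> x \<le> \<eta> $ i - \<eta> $ j" if "x \<in> ?S" for x
    proof -
      have "a j \<bullet> x - \<xi> $ j < a i \<bullet> x - \<xi> $ i" "a i \<bullet> x - \<eta> $ i < a j \<bullet> x - \<eta> $ j"
        using that ij by (auto simp: cell_def)
      then show ?thesis by (simp add: b_def inner_diff_left)
    qed
    then have w: "0 \<le> w" using False unfolding w_def by fastforce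
    have sub: "?S \<subseteq> {x. norm x \<le> R \<and> \<xi> $ i - \<xi> $ j \<le> b \<bullet> x \<and> b \<bullet> x \<le> \<eta> $ i - \<eta> $ j}"
      (is "_ \<subseteq> ?T") using slab R(2) cellD by blast
    have "closed ?T" by (intro closed_Collect_conj closed_Collect_le continuous_intros)
    then have T: "?T \<in> sets lborel" by simp
    have "emeasure ud ?S \<le> ennreal B * emeasure lborel ?S"
      using cellD open_cell by (intro dom) (auto intro!: borel_open open_Int)
    also have "\<dots> \<le> ennreal B * emeasure lborel ?T"
      by (intro mult_left_mono emeasure_mono sub T) simp
    also have "\<dots> \<le> ennreal B * ennreal (2 * R * w / norm b)"
      using slab_emeasure_le[OF b, of "\<xi> $ i - \<xi> $ j" "\<eta> $ i - \<eta> $ j" R] w R(1)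
      by (intro mult_left_mono) (auto simp: w_def)
    also have "\<dots> = ennreal (2 * B * R / norm b * w)"
      using \<open>0 \<le> B\<close> R w by (simp add: ennreal_mult[symmetric] mult_ac)
    finally have "measure ud ?S \<le> 2 * B * R / norm b * w"
      using \<open>0 \<le> B\<close> R w by (simp add: emeasure_eq_measure)
    also have "\<dots> \<le> C * w" using C w by (intro mult_right_mono) (auto simp: b_def)
    also have "\<dots> = C * max 0 ((\<xi> - \<eta>) $ j - (\<xi> - \<eta>) $ i)" using w by (simp add: w_def algebra_simps)
    finally show ?thesis .
  qed
  have "(norm (cell_volumes ud a D \<xi> - cell_volumes ud a D \<eta>))\<^sup>2
      \<le> 2 * CARD('n) * C * - ((cell_volumes ud a D \<xi> - cell_volumes ud a D \<eta>) \<bullet> (\<xi> - \<eta>))" for \<xi> \<eta>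
  proof (rule cocoercive_of_exchange)
    show "(cell_volumes ud a D \<xi> - cell_volumes ud a D \<eta>) $ i
      = (\<Sum>j\<in>UNIV. measure ud (cell a D \<xi> i \<inter> cell a D \<eta> j) - measure ud (cell a D \<xi> j \<inter> cell a D \<eta> i))" for i
      using split[of \<xi> i \<eta>] split[of \<eta> i \<xi>] by (simp add: cell_volumes_def sum_subtractf Int_commute)
  qed (use exchange in auto)
  then show ?thesis using Cpos by (intro exI[of _ "2 * CARD('n) * C"]) auto
qed

lemma density_le_const_times_lborel:
  fixes D :: "'a::euclidean_space set"
  assumes "compact D" and "continuous_on D dens"
    and ud: "ud = density (restrict_space lborel D) (\<lambda>x. ennreal (dens x))"
  obtains B where "0 \<le> B"
    and "\<And>S. S \<in> sets borel \<Longrightarrow> S \<subseteq> D \<Longrightarrow> emeasure ud S \<le> ennreal B * emeasure lborel S"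
proof -
  obtain B where B: "0 < B" "\<And>x. x \<in> D \<Longrightarrow> norm (dens x) \<le> B"
    using compact_imp_bounded[OF compact_continuous_image[OF assms(2,1)]] unfolding bounded_pos by blast
  have D: "D \<in> sets borel" using \<open>compact D\<close> by (rule borel_compact)
  have "continuous_on D (\<lambda>x. ennreal (dens x))"
    by (rule continuous_on_ennreal) fact
  then have "(\<lambda>x. ennreal (dens x)) \<in> borel_measurable (restrict_space borel D)"
    by (rule borel_measurable_continuous_on_restrict)
  then have meas: "(\<lambda>x. ennreal (dens x)) \<in> borel_measurable (restrict_space lborel D)"
    by (simp add: measurable_def sets_restrict_space space_restrict_space)
  have "emeasure ud S \<le> ennreal B * emeasure lborel S" if S: "S \<in> sets borel" "S \<subseteq> D" for S
  proof -
    have S': "S \<in> sets (restrict_space lborel D)" using S D by (simp add: sets_restrict_space_iff)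
    have "emeasure ud S = (\<integral>\<^sup>+x. ennreal (dens x) * indicator S x \<partial>restrict_space lborel D)"
      unfolding ud using meas S' by (rule emeasure_density)
    also have "\<dots> \<le> (\<integral>\<^sup>+x. ennreal B * indicator S x \<partial>restrict_space lborel D)"
      using B S(2) by (intro nn_integral_mono mult_right_mono ennreal_leI) (auto simp: space_restrict_space abs_le_iff)
    also have "\<dots> = ennreal B * emeasure (restrict_space lborel D) S"
      using S' by (rule nn_integral_cmult_indicator)
    also have "emeasure (restrict_space lborel D) S = emeasure lborel S"
      using D S(2) by (intro emeasure_restrict_space) auto
    finally show ?thesis .
  qed
  with B(1) that[of B] show ?thesis by simp
qed

section \<open>A Lyapunov criterion for the fixed-step iteration\<close>

text \<open>The quadratic form \<open>V e = e \<bullet> P e\<close> is a Lyapunov function. Along one step of size \<open>\<tau>\<close> it changes by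
\<open>\<tau>\<close> times its derivative along \<open>r\<close>, which is at most \<open>- \<beta> * V e\<close>, plus \<open>\<tau>\<^sup>2 * V (r x)\<close>, which is
\<open>O(\<tau>\<^sup>2)\<close> times \<open>V e\<close>. For small \<open>\<tau>\<close> at least half of the decay survives, and \<open>V\<close> contracts by the
factor \<open>1 - \<tau> * \<beta> / 2\<close>. As \<open>V\<close> decreases, the iterates stay in the ball where the hypotheses hold.\<close>

lemma euler_iteration_r_linear:
  fixes r :: "'a::euclidean_space \<Rightarrow> 'a"
  assumes P: "linear P" "\<And>x y. x \<bullet> P y = P x \<bullet> y"
    and c: "c > 0" "\<And>x. c * (norm x)\<^sup>2 \<le> x \<bullet> P x"
    and \<delta>: "\<delta> > 0"
    and dissip: "\<And>x. norm (x - z) < \<delta> \<Longrightarrow> 2 * (P (x - z) \<bullet> r x) \<le> - \<beta> * ((x - z) \<bullet> P (x - z))"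
    and bnd: "\<And>x. norm (x - z) < \<delta> \<Longrightarrow> norm (r x) \<le> K * norm (x - z)"
    and \<beta>: "\<beta> > 0"
  shows "\<exists>\<rho>>0. \<exists>\<tau>0>0. \<forall>x0 \<tau>. norm (x0 - z) < \<rho> \<and> 0 < \<tau> \<and> \<tau> < \<tau>0 \<longrightarrow>
    r_linearly_convergent (fixed_step_iteration r \<tau> x0) z"
proof -
  define V where "V e = e \<bullet> P e" for e
  obtain B where B: "B > 0" "\<And>x. norm (P x) \<le> B * norm x"
    using linear_bounded_pos[OF P(1)] by blast
  have V_le: "V e \<le> B * (norm e)\<^sup>2" for e
  proof -
    have "V e \<le> norm e * norm (P e)" unfolding V_def by (rule norm_cauchy_schwarz)
    also have "\<dots> \<le> norm e * (B * norm e)" by (intro mult_left_mono B) simp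
    finally show ?thesis by (simp add: power2_eq_square mult_ac)
  qed
  have le_V: "c * (norm e)\<^sup>2 \<le> V e" for e unfolding V_def by (rule c)
  define Q where "Q = B * K\<^sup>2 / c"
  have Q: "Q \<ge> 0" using B c by (simp add: Q_def)
  \<comment> \<open>The first bound keeps the contraction factor positive, the second makes the quadratic term
    of the step at most half of the linear one.\<close>
  define \<tau>0 where "\<tau>0 = min (1 / \<beta>) (\<beta> / (2 * (Q + 1)))"
  \<comment> \<open>This radius makes \<open>V (x0 - z)\<close> smaller than \<open>c * \<delta>\<^sup>2\<close>, and the sublevel set of \<open>V\<close> at that height
    lies in the ball of radius \<open>\<delta>\<close>.\<close>
  define \<rho> where "\<rho> = \<delta> * sqrt (c / (B + c))"
  have \<tau>0: "\<tau>0 > 0" using \<beta> Q by (simp add: \<tau>0_def)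
  have \<rho>: "\<rho> > 0" using \<delta> B c by (simp add: \<rho>_def)
  have step: "V (x + \<tau> *\<^sub>R r x - z) \<le> (1 - \<tau> * \<beta> / 2) * V (x - z)"
    if x: "norm (x - z) < \<delta>" and \<tau>: "0 < \<tau>" "\<tau> < \<tau>0" for x \<tau>
  proof -
    define e where "e = x - z"
    have "V (r x) \<le> B * (norm (r x))\<^sup>2" by (rule V_le)
    also have "\<dots> \<le> B * (K * norm e)\<^sup>2"
      using bnd[OF x] B(1) by (intro mult_left_mono power_mono) (auto simp: e_def)
    also have "\<dots> = Q * (c * (norm e)\<^sup>2)" using c(1) by (simp add: Q_def power_mult_distrib)
    also have "\<dots> \<le> Q * V e" by (intro mult_left_mono le_V Q)
    finally have Vr: "V (r x) \<le> Q * V e" .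
    have Ve: "V e \<ge> 0" using le_V[of e] c(1) by (smt (verit) mult_nonneg_nonneg zero_le_power2)
    have "\<tau> * Q \<le> \<beta> / 2"
    proof -
      have "\<tau> * (2 * (Q + 1)) \<le> \<beta>" using \<tau> Q by (simp add: \<tau>0_def pos_less_divide_eq)
      then show ?thesis using \<tau> by (simp add: algebra_simps)
    qed
    then have "\<tau> * (\<tau> * Q) * V e \<le> \<tau> * (\<beta> / 2) * V e"
      using \<tau> Ve by (intro mult_right_mono mult_left_mono) auto
    moreover have "\<tau>\<^sup>2 * V (r x) \<le> \<tau>\<^sup>2 * (Q * V e)" using Vr by (intro mult_left_mono) auto
    moreover have "\<tau> * (2 * (P e \<bullet> r x)) \<le> \<tau> * (- \<beta> * V e)"
      using dissip[OF x] \<tau> by (intro mult_left_mono) (auto simp: V_def e_def)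
    moreover have "V (e + \<tau> *\<^sub>R r x) = V e + \<tau> * (2 * (P e \<bullet> r x)) + \<tau>\<^sup>2 * V (r x)"
    proof -
      have "e \<bullet> P (r x) = P e \<bullet> r x" by (rule P)
      moreover have "r x \<bullet> P e = P e \<bullet> r x" by (rule inner_commute)
      ultimately show ?thesis unfolding V_def
        by (simp add: linear_add[OF P(1)] linear_scale[OF P(1)] inner_add_left inner_add_right
            power2_eq_square algebra_simps)
    qed
    ultimately have "V (e + \<tau> *\<^sub>R r x) \<le> (1 - \<tau> * \<beta> / 2) * V e"
      by (simp add: power2_eq_square algebra_simps)
    then show ?thesis by (simp add: e_def algebra_simps)
  qed
  have "r_linearly_convergent (fixed_step_iteration r \<tau> x0) z"
    if x0: "norm (x0 - z) < \<rho>" and \<tau>: "0 < \<tau>" "\<tau> < \<tau>0" for x0 \<tau>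
  proof -
    define x where "x = fixed_step_iteration r \<tau> x0"
    define p where "p = 1 - \<tau> * \<beta> / 2"
    have "\<tau> * \<beta> < 1" using \<tau> \<beta> by (simp add: \<tau>0_def field_simps)
    then have p: "0 < p" "p < 1" using \<tau> \<beta> by (auto simp: p_def)
    have V0: "V (x0 - z) < c * \<delta>\<^sup>2"
    proof -
      have "V (x0 - z) \<le> B * (norm (x0 - z))\<^sup>2" by (rule V_le)
      also have "\<dots> \<le> B * \<rho>\<^sup>2" using x0 B by (intro mult_left_mono power_mono) auto
      also have "\<dots> = c * \<delta>\<^sup>2 * (B / (B + c))"
        using B c by (simp add: \<rho>_def power_mult_distrib)
      also have "\<dots> < c * \<delta>\<^sup>2 * 1" using B c \<delta> by (intro mult_strict_left_mono) auto
      finally show ?thesis by simp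
    qed
    have V0': "0 \<le> V (x0 - z)" using le_V[of "x0 - z"] c(1) by (smt (verit) mult_nonneg_nonneg zero_le_power2)
    have Vk: "V (x k - z) \<le> V (x0 - z) * p ^ k" for k
    proof (induction k)
      case 0
      then show ?case by (simp add: x_def)
    next
      case (Suc k)
      have "c * (norm (x k - z))\<^sup>2 \<le> V (x0 - z) * p ^ k" using le_V Suc order_trans by blast
      also have "\<dots> \<le> V (x0 - z) * 1" using p V0' by (intro mult_left_mono) (auto intro: power_le_one)
      also have "\<dots> < c * \<delta>\<^sup>2" using V0 by simp
      finally have "(norm (x k - z))\<^sup>2 < \<delta>\<^sup>2" using c(1) by simp
      then have "norm (x k - z) < \<delta>" using \<delta> by (auto intro: power2_less_imp_less)
      then have "V (x (Suc k) - z) \<le> p * V (x k - z)"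
        using step[OF _ \<tau>] by (simp add: x_def p_def)
      also have "\<dots> \<le> p * (V (x0 - z) * p ^ k)" using p Suc by (intro mult_left_mono) auto
      finally show ?case by (simp add: mult_ac)
    qed
    have "norm (x k - z) \<le> sqrt (V (x0 - z) / c) * sqrt p ^ k" for k
    proof (rule power2_le_imp_le)
      have "c * (norm (x k - z))\<^sup>2 \<le> V (x0 - z) * p ^ k" using le_V Vk order_trans by blast
      then have "(norm (x k - z))\<^sup>2 \<le> V (x0 - z) / c * p ^ k" using c(1) by (simp add: field_simps)
      also have "\<dots> = (sqrt (V (x0 - z) / c) * sqrt p ^ k)\<^sup>2"
      proof -
        have "(sqrt p ^ k)\<^sup>2 = (sqrt p)\<^sup>2 ^ k" by (simp add: mult.commute flip: power_mult)
        then show ?thesis using V0' c(1) p by (simp add: power_mult_distrib)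
      qed
      finally show "(norm (x k - z))\<^sup>2 \<le> (sqrt (V (x0 - z) / c) * sqrt p ^ k)\<^sup>2" .
    qed (use V0' c(1) p in auto)
    then show ?thesis unfolding r_linearly_convergent_def x_def
      using V0' c(1) p by (intro exI[of _ "sqrt (V (x0 - z) / c)"] conjI exI[of _ "sqrt p"]) auto
  qed
  then show ?thesis using \<tau>0 \<rho> by blast
qed

section \<open>Dissipativity of the residual\<close>

text \<open>The map \<open>P\<close> is the inverse of \<open>A + \<epsilon> I\<close>. The lower bound \<open>\<epsilon>\<close> for \<open>A + \<epsilon> I\<close>, evaluated at \<open>P x\<close>,
gives the inequality between \<open>norm (P x)\<close> and \<open>x \<bullet> P x\<close>; the latter form is coercive because
\<open>A + \<epsilon> I\<close> is bounded.\<close>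

lemma regularized_inverse:
  fixes A :: "'a::euclidean_space \<Rightarrow> 'a"
  assumes A: "linear A" and sym: "\<And>x y. x \<bullet> A y = A x \<bullet> y" and psd: "\<And>x. 0 \<le> x \<bullet> A x" and \<epsilon>: "\<epsilon> > 0"
  obtains P c where "linear P" "\<And>x y. x \<bullet> P y = P x \<bullet> y" "\<And>x. A (P x) + \<epsilon> *\<^sub>R P x = x"
    "\<And>x. \<epsilon> * (norm (P x))\<^sup>2 \<le> x \<bullet> P x" "c > 0" "\<And>x. c * (norm x)\<^sup>2 \<le> x \<bullet> P x"
proof -
  define S where "S x = A x + \<epsilon> *\<^sub>R x" for x
  have S: "linear S" unfolding S_def
    using linear_compose_add[OF A linear_compose_scale_right[OF linear_ident, of \<epsilon>]] by simp
  have Ssym: "x \<bullet> S y = S x \<bullet> y" for x y by (simp add: S_def sym inner_add_left inner_add_right)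
  have coer: "\<epsilon> * (norm x)\<^sup>2 \<le> x \<bullet> S x" for x
    using psd[of x] by (simp add: S_def inner_add_right power2_norm_eq_inner)
  have "inj S"
  proof (rule linear_injective_0[OF S, THEN iffD2], intro allI impI)
    fix x assume "S x = 0"
    then have "\<epsilon> * (norm x)\<^sup>2 \<le> 0" using coer[of x] by simp
    then show "x = 0" using \<epsilon> by (simp add: mult_le_0_iff)
  qed
  then obtain P where P: "linear P" "\<And>x. P (S x) = x" "\<And>x. S (P x) = x"
    using linear_injective_isomorphism[OF S] by auto
  have sp: "P x \<bullet> S (P x) = x \<bullet> P x" for x by (simp add: P inner_commute)
  obtain K where K: "K > 0" "\<And>x. norm (S x) \<le> K * norm x"
    using linear_bounded_pos[OF S] by blast
  show thesis
  proof (rule that[of P "\<epsilon> / K\<^sup>2"])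
    show "x \<bullet> P y = P x \<bullet> y" for x y using Ssym[of "P x" "P y"] by (simp add: P)
    show eP: "\<epsilon> * (norm (P x))\<^sup>2 \<le> x \<bullet> P x" for x using coer[of "P x"] by (simp add: sp)
    show "\<epsilon> / K\<^sup>2 * (norm x)\<^sup>2 \<le> x \<bullet> P x" for x
    proof -
      have "(norm x)\<^sup>2 \<le> (K * norm (P x))\<^sup>2" using K(2)[of "P x"] by (intro power_mono) (auto simp: P)
      then have "\<epsilon> / K\<^sup>2 * (norm x)\<^sup>2 \<le> \<epsilon> / K\<^sup>2 * (K * norm (P x))\<^sup>2"
        using \<epsilon> by (intro mult_left_mono) auto
      also have "\<dots> = \<epsilon> * (norm (P x))\<^sup>2" using K(1) by (simp add: power_mult_distrib)
      finally show ?thesis using eP[of x] by linarith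
    qed
  qed (use P \<epsilon> K in \<open>auto simp: S_def\<close>)
qed

text \<open>With \<open>e = x - z\<close> and \<open>d = U x - U z\<close>, the residual is \<open>A d / \<alpha> - e\<close> up to the linearisation error of
\<open>G\<close>, which is \<open>o(norm d)\<close>. If \<open>A\<close> were invertible, the metric given by its inverse would turn the
product \<open>A d\<close> into the term \<open>e \<bullet> d\<close>, which is nonpositive by cocoercivity. As \<open>A\<close>
may be singular, \<open>P = (A + \<epsilon> I)\<^sup>-\<^sup>1\<close> is used instead. This leaves the extra term
\<open>- \<epsilon> * (P e \<bullet> d)\<close>, which Young's inequality splits between the cocoercivity term
\<open>- (norm d)\<^sup>2 / M\<close> and a small multiple of \<open>\<epsilon> * (norm (P e))\<^sup>2\<close>, itself at most
\<open>e \<bullet> P e\<close>. The damping term \<open>- e\<close> of the residual dominates the rest.\<close>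

lemma fixed_step_local_r_linear:
  fixes U G A :: "'a::euclidean_space \<Rightarrow> 'a"
  assumes "\<alpha> > 0" and M: "M > 0"
    and coco: "\<And>x. (norm (U x - U z))\<^sup>2 \<le> M * - ((U x - U z) \<bullet> (x - z))"
    and der: "(G has_derivative A) (at (U z))"
    and sym: "\<And>x y. x \<bullet> A y = A x \<bullet> y" and psd: "\<And>x. 0 \<le> x \<bullet> A x"
    and r: "\<And>x. r x = h + (1 / \<alpha>) *\<^sub>R G (U x) - x" and zero: "r z = 0"
  shows "\<exists>\<rho>>0. \<exists>\<tau>0>0. \<forall>x0 \<tau>. norm (x0 - z) < \<rho> \<and> 0 < \<tau> \<and> \<tau> < \<tau>0 \<longrightarrow>
    r_linearly_convergent (fixed_step_iteration r \<tau> x0) z"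
proof -
  have linA: "linear A" using has_derivative_linear[OF der] .
  \<comment> \<open>With this value the regularisation costs at most a quarter of the decay \<open>2 * (e \<bullet> P e)\<close>
    that the damping provides.\<close>
  define \<epsilon> where "\<epsilon> = \<alpha> / M"
  have \<epsilon>: "\<epsilon> > 0" using \<open>\<alpha> > 0\<close> M by (simp add: \<epsilon>_def)
  obtain P c where P: "linear P" "\<And>x y. x \<bullet> P y = P x \<bullet> y"
    and inv: "\<And>x. A (P x) + \<epsilon> *\<^sub>R P x = x"
    and eP: "\<And>x. \<epsilon> * (norm (P x))\<^sup>2 \<le> x \<bullet> P x"
    and c: "c > 0" "\<And>x. c * (norm x)\<^sup>2 \<le> x \<bullet> P x"
    using regularized_inverse[OF linA sym psd \<epsilon>] by blast
  obtain B where B: "B > 0" "\<And>x. norm (P x) \<le> B * norm x"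
    using linear_bounded_pos[OF P(1)] by blast
  obtain L where L: "L > 0" "\<And>x. norm (A x) \<le> L * norm x"
    using linear_bounded_pos[OF linA] by blast
  \<comment> \<open>Chosen so that the linearisation error costs at most another quarter of that decay.\<close>
  define \<kappa> where "\<kappa> = c * \<alpha> / (4 * B * M)"
  have \<kappa>: "\<kappa> > 0" using c B M \<open>\<alpha> > 0\<close> by (simp add: \<kappa>_def)
  obtain \<delta> where \<delta>: "\<delta> > 0"
    and lin: "\<And>u. norm (u - U z) < \<delta> \<Longrightarrow> norm (G u - G (U z) - A (u - U z)) \<le> \<kappa> * norm (u - U z)"
    using der \<kappa> unfolding has_derivative_at_alt by blast
  define d where "d x = U x - U z" for x
  define err where "err x = G (U x) - G (U z) - A (d x)" for x
  have lip: "norm (d x) \<le> M * norm (x - z)" for x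
  proof (cases "d x = 0")
    case False
    have "(norm (d x))\<^sup>2 \<le> M * (norm (d x) * norm (x - z))"
      using coco[of x] Cauchy_Schwarz_ineq2[of "d x" "x - z"] M
      by (smt (verit) d_def mult_left_mono)
    then have "norm (d x) * norm (d x) \<le> norm (d x) * (M * norm (x - z))"
      by (simp add: power2_eq_square mult_ac)
    then show ?thesis using False by simp
  qed (use M in auto)
  have rx: "r x = (1 / \<alpha>) *\<^sub>R (A (d x) + err x) - (x - z)" for x
  proof -
    have "r x = r x - r z" by (simp add: zero)
    also have "\<dots> = (1 / \<alpha>) *\<^sub>R (G (U x) - G (U z)) - (x - z)" by (simp add: r algebra_simps)
    finally show ?thesis by (simp add: err_def)
  qed
  have err: "norm (err x) \<le> \<kappa> * M * norm (x - z)" if "norm (x - z) < \<delta> / M" for x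
  proof -
    have "norm (d x) < \<delta>" using lip[of x] that M by (simp add: field_simps)
    then have "norm (err x) \<le> \<kappa> * norm (d x)" using lin[of "U x"] by (simp add: err_def d_def)
    also have "\<dots> \<le> \<kappa> * (M * norm (x - z))" using lip \<kappa> by (intro mult_left_mono) auto
    finally show ?thesis by (simp add: mult_ac)
  qed
  show ?thesis
  proof (rule euler_iteration_r_linear[OF P c, of "\<delta> / M"])
    show "0 < \<delta> / M" using \<delta> M by simp
    show "(0::real) < 1" by simp
    fix x assume x: "norm (x - z) < \<delta> / M"
    define e where "e = x - z"
    define w where "w = P e"
    show "2 * (P (x - z) \<bullet> r x) \<le> - 1 * ((x - z) \<bullet> P (x - z))"
    proof -
      have "w \<bullet> A (d x) = A w \<bullet> d x" by (rule sym)
      also have "A w = e - \<epsilon> *\<^sub>R w" using inv[of e] by (simp add: w_def algebra_simps)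
      finally have "w \<bullet> A (d x) = d x \<bullet> e - \<epsilon> * (w \<bullet> d x)" by (simp add: inner_diff_left inner_commute[of e])
      moreover have "d x \<bullet> e \<le> - ((norm (d x))\<^sup>2 / M)"
        using coco[of x] M by (simp add: d_def e_def field_simps)
      moreover have "- (w \<bullet> d x) \<le> norm w * norm (d x)"
        using Cauchy_Schwarz_ineq2[of w "d x"] by linarith
      then have "\<epsilon> * - (w \<bullet> d x) \<le> \<epsilon> * (norm w * norm (d x))" using \<epsilon> by (intro mult_left_mono) auto
      ultimately have "w \<bullet> A (d x) \<le> \<epsilon> * (norm w * norm (d x)) - (norm (d x))\<^sup>2 / M" by simp
      \<comment> \<open>Young's inequality, by completing the square.\<close>
      also have "\<dots> \<le> M * \<epsilon>\<^sup>2 * (norm w)\<^sup>2 / 4"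
      proof -
        have "0 \<le> (M * \<epsilon> * norm w / 2 - norm (d x))\<^sup>2 / M" using M by simp
        also have "\<dots> = M * \<epsilon>\<^sup>2 * (norm w)\<^sup>2 / 4 - (\<epsilon> * (norm w * norm (d x)) - (norm (d x))\<^sup>2 / M)"
          using M by (simp add: power2_eq_square field_simps)
        finally show ?thesis by simp
      qed
      also have "\<dots> = \<alpha> / 4 * (\<epsilon> * (norm w)\<^sup>2)" using M by (simp add: \<epsilon>_def power2_eq_square)
      also have "\<dots> \<le> \<alpha> / 4 * (e \<bullet> P e)" using eP[of e] \<open>\<alpha> > 0\<close> by (intro mult_left_mono) (auto simp: w_def)
      finally have main: "w \<bullet> A (d x) \<le> \<alpha> / 4 * (e \<bullet> P e)" .
      have "w \<bullet> err x \<le> norm w * norm (err x)" by (rule norm_cauchy_schwarz)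
      also have "\<dots> \<le> (B * norm e) * (\<kappa> * M * norm e)"
        using err[OF x] B \<kappa> M by (intro mult_mono) (auto simp: w_def e_def)
      also have "\<dots> = \<alpha> / 4 * (c * (norm e)\<^sup>2)" using B M by (simp add: \<kappa>_def power2_eq_square)
      also have "\<dots> \<le> \<alpha> / 4 * (e \<bullet> P e)" using c(2)[of e] \<open>\<alpha> > 0\<close> by (intro mult_left_mono) auto
      finally have "w \<bullet> (A (d x) + err x) \<le> \<alpha> / 2 * (e \<bullet> P e)"
        using main by (simp add: inner_add_right)
      then have "(1 / \<alpha>) * (w \<bullet> (A (d x) + err x)) \<le> (1 / \<alpha>) * (\<alpha> / 2 * (e \<bullet> P e))"
        using \<open>\<alpha> > 0\<close> by (intro mult_left_mono) auto
      then have "(1 / \<alpha>) * (w \<bullet> (A (d x) + err x)) \<le> (e \<bullet> P e) / 2"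
        using \<open>\<alpha> > 0\<close> by simp
      moreover have "w \<bullet> r x = (1 / \<alpha>) * (w \<bullet> (A (d x) + err x)) - e \<bullet> P e"
        by (simp add: rx inner_diff_right e_def w_def inner_commute)
      ultimately have "2 * (w \<bullet> r x) \<le> - 1 * (e \<bullet> P e)" by linarith
      then show ?thesis by (simp add: w_def e_def)
    qed
    show "norm (r x) \<le> ((L * M + \<kappa> * M) / \<alpha> + 1) * norm (x - z)"
    proof -
      have "norm (A (d x)) \<le> L * (M * norm (x - z))"
        using L(2)[of "d x"] lip[of x] L(1) by (meson mult_left_mono less_imp_le order_trans)
      then have "norm (A (d x) + err x) \<le> (L * M + \<kappa> * M) * norm (x - z)"
        using err[OF x] norm_triangle_ineq[of "A (d x)" "err x"] by (simp add: algebra_simps)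
      then have "norm ((1 / \<alpha>) *\<^sub>R (A (d x) + err x)) \<le> (L * M + \<kappa> * M) * norm (x - z) / \<alpha>"
        using \<open>\<alpha> > 0\<close> by (simp add: divide_right_mono)
      then show ?thesis
        using norm_triangle_ineq4[of "(1 / \<alpha>) *\<^sub>R (A (d x) + err x)" "x - z"]
        by (simp add: rx distrib_right)
    qed
  qed
qed

section \<open>Local convergence for the cell volumes\<close>

theorem theorem4p5:
  fixes a :: "'n::finite \<Rightarrow> real ^ 2"
    and D :: "(real ^ 2) set"
    and ud :: "(real ^ 2) measure"
    and dens :: "real ^ 2 \<Rightarrow> real"
    and \<alpha> :: real
    and g :: "real ^ 'n \<Rightarrow> real"
    and grad_g :: "real ^ 'n \<Rightarrow> real ^ 'n"
    and H :: "real ^ 'n \<Rightarrow> real ^ 'n ^ 'n"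
    and \<xi>bar :: "real ^ 'n"
  assumes "inj a"
    and "polytope D" and "interior D \<noteq> {}"
    and "continuous_on D dens" and "\<forall>x\<in>D. 0 \<le> dens x"
    and "ud = density (restrict_space lborel D) (\<lambda>x. ennreal (dens x))"
    and "\<alpha> > 0"
    and "twice_cont_differentiable g grad_g H"
    and "residual_map ud a D \<alpha> grad_g \<xi>bar = 0"
    and "pos_semidefinite (H (cell_volumes ud a D \<xi>bar))"
  shows "\<exists>\<rho>>0. \<exists>\<tau>0>0. \<forall>\<xi>0 \<tau>. norm (\<xi>0 - \<xi>bar) < \<rho> \<and> 0 < \<tau> \<and> \<tau> < \<tau>0 \<longrightarrow>
    r_linearly_convergent
      (fixed_step_iteration (residual_map ud a D \<alpha> grad_g) \<tau> \<xi>0) \<xi>bar"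
proof -
  have "compact D" using \<open>polytope D\<close> by (rule polytope_imp_compact)
  obtain B where B: "0 \<le> B"
    "\<And>S. S \<in> sets borel \<Longrightarrow> S \<subseteq> D \<Longrightarrow> emeasure ud S \<le> ennreal B * emeasure lborel S"
    using density_le_const_times_lborel[OF \<open>compact D\<close> \<open>continuous_on D dens\<close> assms(6)] by blast
  have sets: "sets ud = sets (restrict_space borel D)"
    by (simp add: assms(6) sets_restrict_space)
  obtain M where M: "M > 0"
    "\<And>\<xi> \<eta>. (norm (cell_volumes ud a D \<xi> - cell_volumes ud a D \<eta>))\<^sup>2
      \<le> M * - ((cell_volumes ud a D \<xi> - cell_volumes ud a D \<eta>) \<bullet> (\<xi> - \<eta>))"
    using cell_volumes_cocoercive[OF \<open>inj a\<close> compact_imp_bounded[OF \<open>compact D\<close>]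
        borel_compact[OF \<open>compact D\<close>] B(1) sets B(2)] by blast
  have grad: "\<And>y. GDERIV g y :> grad_g y"
    and der: "\<And>y. (grad_g has_derivative (\<lambda>h. H y *v h)) (at y)"
    using assms(8) by (auto simp: twice_cont_differentiable_def)
  let ?A = "\<lambda>h. H (cell_volumes ud a D \<xi>bar) *v h"
  show ?thesis
  proof (rule fixed_step_local_r_linear[OF \<open>\<alpha> > 0\<close> M der])
    show "x \<bullet> ?A y = ?A x \<bullet> y" for x y
      using hessian_symmetric[OF grad der, of x _ y] by (simp add: inner_commute)
    show "0 \<le> x \<bullet> ?A x" for x using assms(10) by (simp add: pos_semidefinite_def)
    show "residual_map ud a D \<alpha> grad_g x
        = half_sq_norms a + (1 / \<alpha>) *\<^sub>R grad_g (cell_volumes ud a D x) - x" for x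
      by (rule residual_map_def)
  qed (rule assms(9))
qed

end
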